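(* Let $n\ge2$, $\gamma\in(0,1)$, $a=1-2\gamma$. Let $V=V(\rho,t)>0$, $\rho\in(0,2)$, $t\in\mathbb R$, be a solution, depending only on $t$ and $\rho$, of the extension problem $$\begin{cases}-\mathrm{div}_{\bar g}(\rho^a\nabla_{\bar g}V)+E(\rho)V=0&\text{in }(X,\bar g),\\ V=v&\text{on }\{\rho=0\},\\ -\tilde d_\gamma\lim_{\rho\to0}\rho^a\partial_\rho V=c_{n,\gamma}v^{\frac{n+2\gamma}{n-2\gamma}}&\text{on }\{\rho=0\}.\end{cases}$$ Then the quantity $$H_\gamma(t):=\frac12\int_0^2\rho^a\left\{e_1(\rho)(\partial_tV)^2-e(\rho)(\partial_\rho V)^2-e_2(\rho)V^2\right\}d\rho+C_{n,\gamma}\,v^{\frac{2n}{n-2\gamma}}$$ is constant with respect to $t$, where $$e_1(\rho)=\left(1+\tfrac{\rho^2}{4}\right)^{-1}\left(1-\tfrac{\rho^2}{4}\right)^{n-1},\quad e_2(\rho)=\tfrac{n-1+a}{4}\left(1-\tfrac{\rho^2}{4}\right)^{n-2}\left(n-2+n\tfrac{\rho^2}{4}\right),$$ $$e(\rho)=\left(1+\tfrac{\rho^2}{4}\right)\left(1-\tfrac{\rho^2}{4}\right)^{n-1},\qquad C_{n,\gamma}=\frac{n-2\gamma}{2n}\,\frac{c_{n,\gamma}}{\tilde d_\gamma}.$$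
   Context: Here $X=(0,2)\times\mathbb R\times\mathbb S^{n-1}$ with coordinates $(\rho,t,\theta)$ and $$\bar g=d\rho^2+\left(1+\tfrac{\rho^2}{4}\right)^2dt^2+\left(1-\tfrac{\rho^2}{4}\right)^2g_{\mathbb S^{n-1}}.$$ The metric $\bar g$ is smooth across $\rho=2$ (the apparent singularity is that of polar coordinates), where the $\mathbb S^{n-1}$ factor collapses. The lower order term is $$E(\rho)=\tfrac{n-1+a}{4}\,\rho^a\,\frac{n-2+n\frac{\rho^2}{4}}{\left(1+\frac{\rho^2}{4}\right)\left(1-\frac{\rho^2}{4}\right)}.$$ For functions $V=V(\rho,t)$ the first equation reads $$-\frac1{e(\rho)}\partial_\rho\left(\rho^ae(\rho)\partial_\rho V\right)-\frac{\rho^a}{(1+\frac{\rho^2}{4})^2}\partial_{tt}V+E(\rho)V=0,\qquad \rho\in(0,2),\ t\in\mathbb R.$$ The constants are $$\tilde d_\gamma=-\frac{2^{2\gamma-1}\Gamma(\gamma)}{\gamma\,\Gamma(-\gamma)},\qquad c_{n,\gamma}=2^{2\gamma}\left(\frac{\Gamma(\frac12(\frac n2+\gamma))}{\Gamma(\frac12(\frac n2-\gamma))}\right)^2.$$ Solutions are positive and classical: $V$ is smooth in the interior, including across $\rho=2$ (as a function on the manifold completed by adding the set $\{\rho=2\}$), and regular up to $\rho=0$ in the sense that $V$, $\partial_tV$, $\partial_{tt}V$, $\rho^a\partial_\rho V$ and $\rho^a\partial_{t\rho}V$ extend continuously to $\rho=0$, with $v=V(0,\cdot)$ smooth. *)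

theory Defs
  imports "HOL-Analysis.Analysis"
begin

text \<open>\<open>Ck_on k S f\<close> and \<open>smooth_on S f\<close> are meant for open \<open>S\<close> only.\<close>

primrec Ck_on :: "nat \<Rightarrow> 'a::real_normed_vector set \<Rightarrow> ('a \<Rightarrow> 'b::real_normed_vector) \<Rightarrow> bool" where
  "Ck_on 0 S f \<longleftrightarrow> continuous_on S f"
| "Ck_on (Suc k) S f \<longleftrightarrow>
     (\<forall>x\<in>S. f differentiable (at x)) \<and> (\<forall>v. Ck_on k S (\<lambda>x. frechet_derivative f (at x) v))"

definition smooth_on :: "'a::real_normed_vector set \<Rightarrow> ('a \<Rightarrow> 'b::real_normed_vector) \<Rightarrow> bool" where
  "smooth_on S f \<longleftrightarrow> (\<forall>k. Ck_on k S f)"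

definition d_rho :: "(real \<Rightarrow> real \<Rightarrow> real) \<Rightarrow> real \<Rightarrow> real \<Rightarrow> real" where
  "d_rho V \<rho> t = deriv (\<lambda>r. V r t) \<rho>"

definition d_t :: "(real \<Rightarrow> real \<Rightarrow> real) \<Rightarrow> real \<Rightarrow> real \<Rightarrow> real" where
  "d_t V \<rho> t = deriv (\<lambda>s. V \<rho> s) t"

definition a_exp :: "real \<Rightarrow> real" where
  "a_exp \<gamma> = 1 - 2 * \<gamma>"

definition d_tilde :: "real \<Rightarrow> real" where
  "d_tilde \<gamma> = - (2 powr (2 * \<gamma> - 1) * Gamma \<gamma>) / (\<gamma> * Gamma (- \<gamma>))"

definition c_const :: "nat \<Rightarrow> real \<Rightarrow> real" where
  "c_const n \<gamma> = 2 powr (2 * \<gamma>) *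
     (Gamma ((real n / 2 + \<gamma>) / 2) / Gamma ((real n / 2 - \<gamma>) / 2))\<^sup>2"

definition C_const :: "nat \<Rightarrow> real \<Rightarrow> real" where
  "C_const n \<gamma> = (real n - 2 * \<gamma>) / (2 * real n) * (c_const n \<gamma> / d_tilde \<gamma>)"

definition e_coef :: "nat \<Rightarrow> real \<Rightarrow> real" where
  "e_coef n \<rho> = (1 + \<rho>\<^sup>2 / 4) * (1 - \<rho>\<^sup>2 / 4) ^ (n - 1)"

definition e1_coef :: "nat \<Rightarrow> real \<Rightarrow> real" where
  "e1_coef n \<rho> = inverse (1 + \<rho>\<^sup>2 / 4) * (1 - \<rho>\<^sup>2 / 4) ^ (n - 1)"

definition e2_coef :: "nat \<Rightarrow> real \<Rightarrow> real \<Rightarrow> real" where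
  "e2_coef n \<gamma> \<rho> = (real n - 1 + a_exp \<gamma>) / 4 * (1 - \<rho>\<^sup>2 / 4) ^ (n - 2)
     * (real n - 2 + real n * (\<rho>\<^sup>2 / 4))"

definition E_coef :: "nat \<Rightarrow> real \<Rightarrow> real \<Rightarrow> real" where
  "E_coef n \<gamma> \<rho> = (real n - 1 + a_exp \<gamma>) / 4 * \<rho> powr a_exp \<gamma>
     * ((real n - 2 + real n * (\<rho>\<^sup>2 / 4)) / ((1 + \<rho>\<^sup>2 / 4) * (1 - \<rho>\<^sup>2 / 4)))"

text \<open>
  The metric is the warped product
  \<open>d\<rho>\<^sup>2 + (warp_t \<rho>)\<^sup>2 dt\<^sup>2 + (warp_S \<rho>)\<^sup>2 g\<close> on \<open>(0,2) \<times> \<real> \<times> S\<^sup>n\<^sup>-\<^sup>1\<close>, where \<open>g\<close> is the round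
  metric.  Its volume density is \<open>vol_dens n \<rho>\<close> times that of the sphere, so for a vector field
  \<open>Y\<^sub>1 \<partial>\<^sub>\<rho> + Y\<^sub>2 \<partial>\<^sub>t\<close> whose coefficients do not depend on the sphere variable the coordinate formula
  \<open>div Y = |g|\<^sup>-\<^sup>1\<^sup>/\<^sup>2 \<Sum>\<^sub>i \<partial>\<^sub>i (|g|\<^sup>1\<^sup>/\<^sup>2 Y\<^sub>i)\<close> gives \<open>div_gbar\<close>; the gradient of a function of \<open>(\<rho>, t)\<close> has
  components \<open>\<partial>\<^sub>\<rho>V\<close> and \<open>(warp_t \<rho>)\<^sup>-\<^sup>2 \<partial>\<^sub>tV\<close>.
\<close>

definition warp_t :: "real \<Rightarrow> real" where
  "warp_t \<rho> = 1 + \<rho>\<^sup>2 / 4"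

definition warp_S :: "real \<Rightarrow> real" where
  "warp_S \<rho> = 1 - \<rho>\<^sup>2 / 4"

definition vol_dens :: "nat \<Rightarrow> real \<Rightarrow> real" where
  "vol_dens n \<rho> = warp_t \<rho> * warp_S \<rho> ^ (n - 1)"

definition div_gbar ::
    "nat \<Rightarrow> (real \<Rightarrow> real \<Rightarrow> real) \<Rightarrow> (real \<Rightarrow> real \<Rightarrow> real) \<Rightarrow> real \<Rightarrow> real \<Rightarrow> real" where
  "div_gbar n Y1 Y2 \<rho> t = 1 / vol_dens n \<rho> *
     (d_rho (\<lambda>r s. vol_dens n r * Y1 r s) \<rho> t + d_t (\<lambda>r s. vol_dens n r * Y2 r s) \<rho> t)"

definition weighted_div_grad :: "nat \<Rightarrow> real \<Rightarrow> (real \<Rightarrow> real \<Rightarrow> real) \<Rightarrow> real \<Rightarrow> real \<Rightarrow> real" where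
  "weighted_div_grad n \<gamma> V = div_gbar n
     (\<lambda>\<rho> t. \<rho> powr a_exp \<gamma> * d_rho V \<rho> t)
     (\<lambda>\<rho> t. \<rho> powr a_exp \<gamma> * (d_t V \<rho> t / (warp_t \<rho>)\<^sup>2))"

lemma weighted_div_grad_eq:
  assumes "0 < \<rho>" "\<rho> < 2" and "(\<lambda>s. d_t V \<rho> s) field_differentiable at t"
  shows "- weighted_div_grad n \<gamma> V \<rho> t =
    - (1 / e_coef n \<rho>) * d_rho (\<lambda>r s. r powr a_exp \<gamma> * e_coef n r * d_rho V r s) \<rho> t
    - \<rho> powr a_exp \<gamma> / (1 + \<rho>\<^sup>2 / 4)\<^sup>2 * d_t (d_t V) \<rho> t"
proof -
  have e: "vol_dens n = e_coef n"
    by (simp add: fun_eq_iff vol_dens_def e_coef_def warp_t_def warp_S_def)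
  have "\<rho>\<^sup>2 < 2\<^sup>2"
    using assms by (intro power_strict_mono) auto
  then have ne: "e_coef n \<rho> \<noteq> 0"
    by (simp add: e_coef_def add_pos_nonneg order_less_imp_not_eq2)
  have "d_t (\<lambda>r s. e_coef n r * (r powr a_exp \<gamma> * (d_t V r s / (warp_t r)\<^sup>2))) \<rho> t
      = deriv (\<lambda>s. (e_coef n \<rho> * \<rho> powr a_exp \<gamma> / (warp_t \<rho>)\<^sup>2) * d_t V \<rho> s) t"
    by (subst d_t_def) (simp add: ac_simps)
  also have "\<dots> = e_coef n \<rho> * \<rho> powr a_exp \<gamma> / (warp_t \<rho>)\<^sup>2 * d_t (d_t V) \<rho> t"
    using assms(3) by (subst deriv_cmult) (auto simp: d_t_def[of "d_t V"])
  finally show ?thesis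
    using ne by (simp add: weighted_div_grad_def div_gbar_def e warp_t_def algebra_simps)
qed

definition extends_to_zero :: "(real \<Rightarrow> real \<Rightarrow> real) \<Rightarrow> bool" where
  "extends_to_zero F \<longleftrightarrow>
     (\<exists>G. continuous_on ({0..<2} \<times> UNIV) G \<and> (\<forall>\<rho>\<in>{0<..<2}. \<forall>t. G (\<rho>, t) = F \<rho> t))"

text \<open>
  \<open>smooth_up_to_axis V\<close>: \<open>V\<close>, given on \<open>0 < \<rho> < 2\<close>, is smooth in \<open>(\<rho>, t)\<close> there and across
  \<open>\<rho> = 2\<close> along the geodesics \<open>\<theta>\<close> = const, that is, it extends smoothly to an open neighbourhood of
  \<open>(0,2] \<times> \<real>\<close>.  Evenness of the extension in \<open>2 - \<rho>\<close> is deliberately not required: since \<open>E_coef\<close>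
  has a pole at \<open>\<rho> = 2\<close>, it would exclude every positive solution (these have the form
  \<open>\<rho>\<^sup>k u\<close>, with \<open>u\<close> smooth and even in \<open>ln (2/\<rho>)\<close> and \<open>k \<noteq> 0\<close>).
\<close>

definition smooth_up_to_axis :: "(real \<Rightarrow> real \<Rightarrow> real) \<Rightarrow> bool" where
  "smooth_up_to_axis V \<longleftrightarrow>
     (\<exists>U W. open U \<and> {0<..2} \<times> UNIV \<subseteq> U \<and> smooth_on U W \<and>
        (\<forall>\<rho>\<in>{0<..<2}. \<forall>t. W (\<rho>, t) = V \<rho> t))"

definition regular_up_to_boundary :: "real \<Rightarrow> (real \<Rightarrow> real \<Rightarrow> real) \<Rightarrow> bool" where
  "regular_up_to_boundary \<gamma> V \<longleftrightarrow>
     extends_to_zero V \<and>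
     extends_to_zero (d_t V) \<and>
     extends_to_zero (d_t (d_t V)) \<and>
     extends_to_zero (\<lambda>\<rho> t. \<rho> powr a_exp \<gamma> * d_rho V \<rho> t) \<and>
     extends_to_zero (\<lambda>\<rho> t. \<rho> powr a_exp \<gamma> * d_t (d_rho V) \<rho> t)"

definition ham_integrand :: "nat \<Rightarrow> real \<Rightarrow> (real \<Rightarrow> real \<Rightarrow> real) \<Rightarrow> real \<Rightarrow> real \<Rightarrow> real" where
  "ham_integrand n \<gamma> V t \<rho> = \<rho> powr a_exp \<gamma> *
     (e1_coef n \<rho> * (d_t V \<rho> t)\<^sup>2 - e_coef n \<rho> * (d_rho V \<rho> t)\<^sup>2 - e2_coef n \<gamma> \<rho> * (V \<rho> t)\<^sup>2)"

definition hamiltonian :: "nat \<Rightarrow> real \<Rightarrow> (real \<Rightarrow> real \<Rightarrow> real) \<Rightarrow> (real \<Rightarrow> real) \<Rightarrow> real \<Rightarrow> real" where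
  "hamiltonian n \<gamma> V v t =
     1 / 2 * (LINT \<rho>:{0<..<2}|lborel. ham_integrand n \<gamma> V t \<rho>)
     + C_const n \<gamma> * v t powr (2 * real n / (real n - 2 * \<gamma>))"

end

theory Submission
  imports Defs
begin

text \<open>
  The quantity \<open>H\<^sub>\<gamma>\<close> is the Hamiltonian of the extension problem in the time variable \<open>t\<close>.  Write
  \<open>Q(F, G)\<close> for the symmetric bilinear form
  \<open>\<integral>\<^sub>0\<^sup>2 \<rho>\<^sup>a (e\<^sub>1 \<partial>\<^sub>tF \<partial>\<^sub>tG - e \<partial>\<^sub>\<rho>F \<partial>\<^sub>\<rho>G - e\<^sub>2 F G) d\<rho>\<close>, whose integrand is \<open>energy_form\<close>; then
  \<open>H\<^sub>\<gamma> = Q(V, V) / 2 + C v\<^sup>p\<close> with \<open>p = 2n / (n - 2\<gamma>)\<close>.  Since the coefficients do not depend on \<open>t\<close>,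
  differentiation gives \<open>H\<^sub>\<gamma>' = Q(V, \<partial>\<^sub>tV) + C p v\<^sup>p\<^sup>-\<^sup>1 v'\<close>.

  Multiplied by \<open>e\<close>, the equation reads \<open>\<partial>\<^sub>\<rho>(\<rho>\<^sup>a e \<partial>\<^sub>\<rho>V) = \<rho>\<^sup>a (e\<^sub>2 V - e\<^sub>1 \<partial>\<^sub>t\<^sub>tV)\<close>.  Hence the integrand of
  \<open>Q(V, \<partial>\<^sub>tV)\<close> is exactly \<open>- \<partial>\<^sub>\<rho>(\<rho>\<^sup>a e \<partial>\<^sub>\<rho>V \<partial>\<^sub>tV)\<close>, and the integral is the difference of the limits of
  the flux \<open>\<rho>\<^sup>a e \<partial>\<^sub>\<rho>V \<partial>\<^sub>tV\<close>.  At \<open>\<rho> = 2\<close> it vanishes, because \<open>e\<close> does and the derivatives of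
  \<open>V\<close> stay bounded; at \<open>\<rho> = 0\<close> it tends to \<open>L v'\<close>, where \<open>L = lim \<rho>\<^sup>a \<partial>\<^sub>\<rho>V\<close>.  So
  \<open>Q(V, \<partial>\<^sub>tV) = L v'\<close> (\<open>integral_energy_form_d_t\<close>).  The boundary condition says
  \<open>L = - (c / d) v\<^sup>p\<^sup>-\<^sup>1\<close>, with \<open>c\<close> and \<open>d\<close> the constants \<open>c_const\<close> and \<open>d_tilde\<close>, and
  \<open>C p = c / d\<close>, so that the two contributions cancel.

  The analytic points behind this computation are the following.
  \<^item> Differentiation under the integral (\<open>has_real_derivative_set_integral\<close>) needs an integrable
    majorant that is uniform in \<open>t\<close>.  Near \<open>\<rho> = 0\<close> only \<open>\<rho>\<^sup>a \<partial>\<^sub>\<rho>V\<close> is bounded, not \<open>\<partial>\<^sub>\<rho>V\<close>, so that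
    \<open>\<rho>\<^sup>a (\<partial>\<^sub>\<rho>V)\<^sup>2\<close> is of size \<open>\<rho>\<^sup>-\<^sup>a\<close>.  The majorant \<open>M (\<rho>\<^sup>a + \<rho>\<^sup>-\<^sup>a)\<close> of \<open>energy_form_bound\<close> is
    integrable since \<open>-1 < a < 1\<close>.
  \<^item> The mixed derivatives agree (\<open>has_d_rho_d_t\<close>): \<open>\<partial>\<^sub>t\<partial>\<^sub>\<rho>V\<close> comes from differentiating the energy,
    \<open>\<partial>\<^sub>\<rho>\<partial>\<^sub>tV\<close> from differentiating the flux.
  \<^item> The limit of \<open>\<partial>\<^sub>tV\<close> at \<open>\<rho> = 0\<close> is the derivative of the trace \<open>v\<close>
    (\<open>boundary_trace_derivative\<close>).
  \<^item> As a limit of positive functions, \<open>v\<close> is only known to be nonnegative; \<open>v\<^sup>p\<close> is nevertheless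
    differentiable at its zeros because \<open>p > 1\<close> (\<open>has_real_derivative_powr_nonneg\<close>).
\<close>

section \<open>Integrals and powers on the real line\<close>

lemma set_integrable_powr_interval:
  fixes p :: real
  assumes "p > -1"
  shows "set_integrable lborel {0<..<2} (\<lambda>x. x powr p)"
proof -
  have "set_integrable lborel (einterval 0 2) (\<lambda>x. x powr p)"
  proof (rule interval_integral_FTC_nonneg(1)[where F = "\<lambda>x. x powr (p + 1) / (p + 1)"])
    show "DERIV (\<lambda>x. x powr (p + 1) / (p + 1)) x :> x powr p" if "0 < ereal x" "ereal x < 2" for x
      using that assms by (auto intro!: derivative_eq_intros simp: zero_ereal_def)
    show "isCont (\<lambda>x. x powr p) x" if "0 < ereal x" "ereal x < 2" for x
      using that by (auto intro!: continuous_intros simp: zero_ereal_def)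
    have "((\<lambda>x. x powr (p + 1) / (p + 1)) \<longlongrightarrow> 0 powr (p + 1) / (p + 1)) (at_right 0)"
      using assms by (intro tendsto_intros) (auto simp: eventually_at_filter)
    then show "(((\<lambda>x. x powr (p + 1) / (p + 1)) \<circ> real_of_ereal) \<longlongrightarrow> 0 powr (p + 1) / (p + 1)) (at_right 0)"
      by (simp add: zero_ereal_def ereal_tendsto_simps1)
    have "((\<lambda>x. x powr (p + 1) / (p + 1)) \<longlongrightarrow> 2 powr (p + 1) / (p + 1)) (at_left 2)"
      using assms by (intro tendsto_intros) auto
    then show "(((\<lambda>x. x powr (p + 1) / (p + 1)) \<circ> real_of_ereal) \<longlongrightarrow> 2 powr (p + 1) / (p + 1)) (at_left 2)"
      by (simp add: numeral_eq_ereal ereal_tendsto_simps1)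
  qed auto
  also have "einterval 0 2 = {0<..<2::real}"
    by (auto simp: einterval_iff zero_ereal_def numeral_eq_ereal)
  finally show ?thesis .
qed

text \<open>
  The difference quotients in the parameter converge pointwise to \<open>f' t\<close>, and by the mean value
  inequality they inherit the majorant \<open>g\<close> of the derivatives; dominated convergence does the rest.
  Asking for the majorant only near \<open>t\<close> matters, since the regularity of \<open>V\<close> yields bounds that
  are uniform merely for \<open>t\<close> in compact intervals.
\<close>

lemma has_real_derivative_set_integral:
  fixes f f' :: "real \<Rightarrow> 'a \<Rightarrow> real"
  assumes A: "A \<in> sets M"
    and f: "\<And>s. set_integrable M A (f s)"
    and f': "set_integrable M A (f' t)"
    and deriv: "\<And>s x. x \<in> A \<Longrightarrow> ((\<lambda>s. f s x) has_real_derivative f' s x) (at s)"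
    and g: "set_integrable M A g"
    and bound: "\<And>s x. x \<in> A \<Longrightarrow> \<bar>s - t\<bar> \<le> 1 \<Longrightarrow> \<bar>f' s x\<bar> \<le> g x"
  shows "((\<lambda>s. LINT x:A|M. f s x) has_real_derivative (LINT x:A|M. f' t x)) (at t)"
proof -
  define q where "q h x = (f (t + h) x - f t x) / h" for h x
  have q_eq: "((LINT x:A|M. f (t + h) x) - (LINT x:A|M. f t x)) / h = (LINT x:A|M. q h x)" for h
    unfolding q_def by (simp add: f set_integral_diff)
  have q_int: "set_integrable M A (q h)" for h
    unfolding q_def by (simp add: f set_integral_diff)
  have q_bound: "\<bar>q h x\<bar> \<le> g x" if x: "x \<in> A" and h: "\<bar>h\<bar> \<le> 1" for h x
  proof (cases "h = 0")
    case True
    with bound[OF x, of t] show ?thesis by (simp add: q_def)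
  next
    case False
    have "norm (f (t + h) x - f t x) \<le> g x * norm (t + h - t)"
    proof (rule field_differentiable_bound[of "{t-1..t+1}"])
      show "((\<lambda>s. f s x) has_field_derivative f' s x) (at s within {t-1..t+1})" for s
        using deriv[OF x] by (rule has_field_derivative_at_within)
      show "norm (f' s x) \<le> g x" if "s \<in> {t-1..t+1}" for s
        using bound[OF x, of s] that by (auto simp: abs_le_iff)
    qed (use h in \<open>auto simp: abs_le_iff\<close>)
    with False show ?thesis by (simp add: q_def abs_divide divide_le_eq)
  qed
  have "(\<lambda>i. LINT x:A|M. q (X i) x) \<longlonglongrightarrow> (LINT x:A|M. f' t x)"
    if X: "\<And>i. X i \<noteq> 0" "X \<longlonglongrightarrow> 0" for X :: "nat \<Rightarrow> real"
  proof -
    have "eventually (\<lambda>i. \<bar>X i\<bar> < 1) sequentially"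
      using tendsto_rabs[OF X(2)] by (rule order_tendstoD(2)) simp
    then obtain N where N: "\<And>i. i \<ge> N \<Longrightarrow> \<bar>X i\<bar> < 1"
      by (auto simp: eventually_sequentially)
    have "(\<lambda>i. LINT x:A|M. q (X (i + N)) x) \<longlonglongrightarrow> (LINT x:A|M. f' t x)"
      unfolding set_lebesgue_integral_def
    proof (rule integral_dominated_convergence)
      show "(\<lambda>x. indicat_real A x *\<^sub>R f' t x) \<in> borel_measurable M"
        using f' unfolding set_integrable_def by blast
      show "(\<lambda>x. indicat_real A x *\<^sub>R q (X (i + N)) x) \<in> borel_measurable M" for i
        using q_int unfolding set_integrable_def by blast
      show "integrable M (\<lambda>x. indicat_real A x *\<^sub>R g x)"
        using g unfolding set_integrable_def .
      have "(\<lambda>i. q (X (i + N)) x) \<longlonglongrightarrow> f' t x" if "x \<in> A" for x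
      proof -
        have "((\<lambda>h. q h x) \<longlongrightarrow> f' t x) (at 0)"
          using deriv[OF that, of t] by (simp add: DERIV_def q_def)
        then have "(\<lambda>i. q (X i) x) \<longlonglongrightarrow> f' t x"
          using X by (auto simp: tendsto_at_iff_sequentially o_def)
        then show ?thesis by (rule LIMSEQ_ignore_initial_segment)
      qed
      then show "AE x in M. (\<lambda>i. indicat_real A x *\<^sub>R q (X (i + N)) x)
          \<longlonglongrightarrow> indicat_real A x *\<^sub>R f' t x"
        by (intro AE_I2) (auto simp: indicator_def)
      show "AE x in M. norm (indicat_real A x *\<^sub>R q (X (i + N)) x) \<le> indicat_real A x *\<^sub>R g x" for i
        using q_bound N[of "i + N"] by (intro AE_I2) (auto simp: indicator_def less_imp_le)
    qed
    then show ?thesis by (rule LIMSEQ_offset)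
  qed
  then have "((\<lambda>h. LINT x:A|M. q h x) \<longlongrightarrow> (LINT x:A|M. f' t x)) (at 0)"
    by (auto simp: tendsto_at_iff_sequentially o_def)
  then show ?thesis
    by (simp add: DERIV_def q_eq)
qed

text \<open>
  The chain rule covers \<open>v t > 0\<close>.  A zero of \<open>v\<close> is a minimum, so \<open>D = 0\<close> there, and the difference
  quotient of \<open>v powr p\<close> is that of \<open>v\<close> times the factor \<open>v powr (p - 1)\<close>, which tends to \<open>0\<close>.
\<close>

lemma has_real_derivative_powr_nonneg:
  fixes v :: "real \<Rightarrow> real"
  assumes nonneg: "\<And>s. v s \<ge> 0" and v: "(v has_real_derivative D) (at t)" and p: "p > 1"
  shows "((\<lambda>s. v s powr p) has_real_derivative p * v t powr (p - 1) * D) (at t)"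
proof (cases "v t = 0")
  case False
  then have "v t > 0" using nonneg[of t] by simp
  then show ?thesis
    using has_real_derivative_powr[of "v t" p] v DERIV_chain2 by blast
next
  case True
  have "D = 0"
    using v by (rule DERIV_local_min[where d = 1]) (use True nonneg in auto)
  have "((\<lambda>h. (v (t + h) - v t) / h) \<longlongrightarrow> 0) (at 0)"
    using v \<open>D = 0\<close> by (simp add: DERIV_def)
  moreover have "((\<lambda>h. v (t + h) powr (p - 1)) \<longlongrightarrow> 0) (at 0)"
  proof -
    have "isCont v t" using v by (rule DERIV_isCont)
    then have "((\<lambda>h. v (t + h)) \<longlongrightarrow> 0) (at 0)"
      using True by (simp add: isCont_def LIM_offset_zero_iff[of t])
    then have "((\<lambda>h. v (t + h) powr (p - 1)) \<longlongrightarrow> 0 powr (p - 1)) (at 0)"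
      using p nonneg by (intro tendsto_powr') auto
    then show ?thesis by simp
  qed
  ultimately have "((\<lambda>h. (v (t + h) - v t) / h * v (t + h) powr (p - 1)) \<longlongrightarrow> 0) (at 0)"
    by (rule tendsto_mult_zero)
  moreover have "(\<lambda>h. (v (t + h) - v t) / h * v (t + h) powr (p - 1)) = (\<lambda>h. v (t + h) powr p / h)"
  proof
    fix h
    have "v (t + h) * v (t + h) powr (p - 1) = v (t + h) powr p"
      using nonneg[of "t + h"] powr_add[of "v (t + h)" 1 "p - 1"] by (cases "v (t + h) = 0") auto
    then show "(v (t + h) - v t) / h * v (t + h) powr (p - 1) = v (t + h) powr p / h"
      using True by simp
  qed
  ultimately show ?thesis
    using True \<open>D = 0\<close> by (simp add: DERIV_def)
qed

lemma set_integral_FTC_Ioo: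
  fixes f F :: "real \<Rightarrow> real" and a b :: real
  assumes "a < b"
    and F: "\<And>x. x \<in> {a<..<b} \<Longrightarrow> (F has_real_derivative f x) (at x)"
    and f: "continuous_on {a<..<b} f" "set_integrable lborel {a<..<b} f"
    and lim: "(F \<longlongrightarrow> A) (at_right a)" "(F \<longlongrightarrow> B) (at_left b)"
  shows "(LINT x:{a<..<b}|lborel. f x) = B - A"
proof -
  have *: "einterval (ereal a) (ereal b) = {a<..<b}"
    by (auto simp: einterval_iff)
  have "(LBINT x=ereal a..ereal b. f x) = B - A"
  proof (rule interval_integral_FTC_integrable)
    show "isCont f x" if "ereal a < ereal x" "ereal x < ereal b" for x
      using f(1) that by (auto simp: continuous_on_eq_continuous_at)
    show "(F has_vector_derivative f x) (at x)" if "ereal a < ereal x" "ereal x < ereal b" for x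
      using F that by (auto simp: has_real_derivative_iff_has_vector_derivative)
  qed (use assms * in \<open>auto simp: ereal_tendsto_simps1\<close>)
  then show ?thesis
    using \<open>a < b\<close> by (simp add: interval_lebesgue_integral_le_eq *)
qed

section \<open>Partial derivatives of functions smooth up to the axis\<close>

lemma smooth_on_frechet_derivative:
  "smooth_on U W \<Longrightarrow> smooth_on U (\<lambda>x. frechet_derivative W (at x) v)"
  unfolding smooth_on_def by (metis Ck_on.simps(2))

lemma smooth_on_has_derivative:
  "smooth_on U W \<Longrightarrow> x \<in> U \<Longrightarrow> (W has_derivative frechet_derivative W (at x)) (at x)"
  unfolding smooth_on_def by (metis Ck_on.simps(2) frechet_derivative_works)

lemma smooth_on_continuous_on: "smooth_on U W \<Longrightarrow> continuous_on U W"
  unfolding smooth_on_def by (metis Ck_on.simps(1))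

text \<open>
  On the open strip the partial derivatives of \<open>F\<close> are directional derivatives of a smooth extension
  \<open>W\<close>, and these are again smooth on the whole domain of \<open>W\<close>.  This makes smoothness up to the axis
  stable under both partial derivatives.
\<close>

lemma smooth_up_to_axis_partials:
  assumes "smooth_up_to_axis F"
  obtains U W where "open U" "{0<..2} \<times> UNIV \<subseteq> U" "smooth_on U W"
    "\<And>\<rho> t. \<rho> \<in> {0<..<2} \<Longrightarrow>
      ((\<lambda>r. F r t) has_real_derivative frechet_derivative W (at (\<rho>, t)) (1, 0)) (at \<rho>)"
    "\<And>\<rho> t. \<rho> \<in> {0<..<2} \<Longrightarrow>
      ((\<lambda>s. F \<rho> s) has_real_derivative frechet_derivative W (at (\<rho>, t)) (0, 1)) (at t)"
proof -
  obtain U W where UW: "open U" "{0<..2} \<times> UNIV \<subseteq> U" "smooth_on U W"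
    and W: "\<And>\<rho> t. \<rho> \<in> {0<..<2} \<Longrightarrow> W (\<rho>, t) = F \<rho> t"
    using assms unfolding smooth_up_to_axis_def by blast
  have D: "(W has_derivative frechet_derivative W (at (\<rho>, t))) (at (\<rho>, t))"
    if "\<rho> \<in> {0<..<2}" for \<rho> t
    using UW(2) that by (intro smooth_on_has_derivative[OF UW(3)]) auto
  have lin: "frechet_derivative W (at (\<rho>, t)) (c *\<^sub>R x) = c * frechet_derivative W (at (\<rho>, t)) x"
    if "\<rho> \<in> {0<..<2}" for \<rho> t c x
    using linear_scale[OF bounded_linear.linear[OF has_derivative_bounded_linear[OF D[OF that]]]] by simp
  have lin1: "(\<lambda>h. frechet_derivative W (at (\<rho>, t)) (h, 0)) =
      (*) (frechet_derivative W (at (\<rho>, t)) (1, 0))" if "\<rho> \<in> {0<..<2}" for \<rho> t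
  proof
    fix h
    show "frechet_derivative W (at (\<rho>, t)) (h, 0) = frechet_derivative W (at (\<rho>, t)) (1, 0) * h"
      using lin[OF that, of t h "(1, 0)"] by simp
  qed
  have lin2: "(\<lambda>h. frechet_derivative W (at (\<rho>, t)) (0, h)) =
      (*) (frechet_derivative W (at (\<rho>, t)) (0, 1))" if "\<rho> \<in> {0<..<2}" for \<rho> t
  proof
    fix h
    show "frechet_derivative W (at (\<rho>, t)) (0, h) = frechet_derivative W (at (\<rho>, t)) (0, 1) * h"
      using lin[OF that, of t h "(0, 1)"] by simp
  qed
  have 1: "((\<lambda>r. F r t) has_real_derivative frechet_derivative W (at (\<rho>, t)) (1, 0)) (at \<rho>)"
    if \<rho>: "\<rho> \<in> {0<..<2}" for \<rho> t
  proof -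
    have "((\<lambda>r. W (r, t)) has_derivative (\<lambda>h. frechet_derivative W (at (\<rho>, t)) (h, 0))) (at \<rho>)"
      by (rule has_derivative_compose[where f = "\<lambda>r. (r, t)" and f' = "\<lambda>h. (h, 0)", OF _ D[OF \<rho>]])
        (auto intro!: derivative_eq_intros)
    then have "((\<lambda>r. W (r, t)) has_real_derivative frechet_derivative W (at (\<rho>, t)) (1, 0)) (at \<rho>)"
      by (simp add: has_field_derivative_def lin1[OF \<rho>])
    then show ?thesis
      by (rule has_field_derivative_transform_within_open[where S = "{0<..<2}"]) (use \<rho> W in auto)
  qed
  have 2: "((\<lambda>s. F \<rho> s) has_real_derivative frechet_derivative W (at (\<rho>, t)) (0, 1)) (at t)"
    if \<rho>: "\<rho> \<in> {0<..<2}" for \<rho> t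
  proof -
    have "((\<lambda>s. W (\<rho>, s)) has_derivative (\<lambda>h. frechet_derivative W (at (\<rho>, t)) (0, h))) (at t)"
      by (rule has_derivative_compose[where f = "\<lambda>s. (\<rho>, s)" and f' = "\<lambda>h. (0, h)", OF _ D[OF \<rho>]])
        (auto intro!: derivative_eq_intros)
    then show ?thesis
      using W[OF \<rho>] by (simp add: has_field_derivative_def lin2[OF \<rho>])
  qed
  show ?thesis using that[OF UW 1 2] by blast
qed

lemma
  assumes F: "smooth_up_to_axis F"
  shows smooth_up_to_axis_d_rho: "smooth_up_to_axis (d_rho F)"
    and smooth_up_to_axis_d_t: "smooth_up_to_axis (d_t F)"
    and has_d_rho: "\<rho> \<in> {0<..<2} \<Longrightarrow> ((\<lambda>r. F r t) has_real_derivative d_rho F \<rho> t) (at \<rho>)"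
    and has_d_t: "\<rho> \<in> {0<..<2} \<Longrightarrow> ((\<lambda>s. F \<rho> s) has_real_derivative d_t F \<rho> t) (at t)"
proof -
  obtain U W where UW: "open U" "{0<..2} \<times> UNIV \<subseteq> U" "smooth_on U W"
    and \<rho>: "\<And>\<rho> t. \<rho> \<in> {0<..<2} \<Longrightarrow>
      ((\<lambda>r. F r t) has_real_derivative frechet_derivative W (at (\<rho>, t)) (1, 0)) (at \<rho>)"
    and t: "\<And>\<rho> t. \<rho> \<in> {0<..<2} \<Longrightarrow>
      ((\<lambda>s. F \<rho> s) has_real_derivative frechet_derivative W (at (\<rho>, t)) (0, 1)) (at t)"
    by (rule smooth_up_to_axis_partials[OF F]) blast
  have eq: "d_rho F \<rho> t = frechet_derivative W (at (\<rho>, t)) (1, 0)"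
    "d_t F \<rho> t = frechet_derivative W (at (\<rho>, t)) (0, 1)" if "\<rho> \<in> {0<..<2}" for \<rho> t
    using \<rho>[OF that] t[OF that] by (auto simp: d_rho_def d_t_def intro: DERIV_imp_deriv)
  show "smooth_up_to_axis (d_rho F)"
    unfolding smooth_up_to_axis_def
    using UW smooth_on_frechet_derivative[OF UW(3)] eq
    by (intro exI[of _ U] exI[of _ "\<lambda>x. frechet_derivative W (at x) (1, 0)"]) simp
  show "smooth_up_to_axis (d_t F)"
    unfolding smooth_up_to_axis_def
    using UW smooth_on_frechet_derivative[OF UW(3)] eq
    by (intro exI[of _ U] exI[of _ "\<lambda>x. frechet_derivative W (at x) (0, 1)"]) simp
  show "((\<lambda>r. F r t) has_real_derivative d_rho F \<rho> t) (at \<rho>)" if "\<rho> \<in> {0<..<2}"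
    using \<rho>[OF that] eq(1)[OF that] by simp
  show "((\<lambda>s. F \<rho> s) has_real_derivative d_t F \<rho> t) (at t)" if "\<rho> \<in> {0<..<2}"
    using t[OF that] eq(2)[OF that] by simp
qed

text \<open>
  The counterpart of \<open>extends_to_zero\<close> at the other end \<open>\<rho> = 2\<close>.  Unlike \<open>smooth_up_to_axis\<close> it passes
  to products with powers of \<open>\<rho>\<close> without a discussion of their smoothness.
\<close>

definition extends_to_axis :: "(real \<Rightarrow> real \<Rightarrow> real) \<Rightarrow> bool" where
  "extends_to_axis F \<longleftrightarrow>
     (\<exists>G. continuous_on ({0<..2} \<times> UNIV) G \<and> (\<forall>\<rho>\<in>{0<..<2}. \<forall>t. G (\<rho>, t) = F \<rho> t))"

lemma smooth_imp_extends_to_axis: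
  "smooth_up_to_axis F \<Longrightarrow> extends_to_axis F"
  unfolding smooth_up_to_axis_def extends_to_axis_def
  by (meson continuous_on_subset smooth_on_continuous_on)

lemma extends_to_axis_continuous_on:
  assumes "extends_to_axis F"
  shows "continuous_on ({0<..<2} \<times> UNIV) (\<lambda>x. F (fst x) (snd x))"
proof -
  obtain G where G: "continuous_on ({0<..2} \<times> UNIV) G" "\<And>\<rho> t. \<rho> \<in> {0<..<2} \<Longrightarrow> G (\<rho>, t) = F \<rho> t"
    using assms unfolding extends_to_axis_def by blast
  have "continuous_on ({0<..<2} \<times> UNIV) G"
    by (rule continuous_on_subset[OF G(1)]) auto
  then show ?thesis
    by (rule continuous_on_eq) (auto simp: G(2))
qed

text \<open>
  Equality of mixed derivatives, by integration: differentiate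
  \<open>F(r, s) = F(a, s) + \<integral>\<^sub>a\<^sup>r \<partial>\<^sub>\<rho>F(x, s) dx\<close> in \<open>s\<close> under the integral, and the result
  \<open>\<partial>\<^sub>tF(r, t) = \<partial>\<^sub>tF(a, t) + \<integral>\<^sub>a\<^sup>r \<partial>\<^sub>t\<partial>\<^sub>\<rho>F(x, t) dx\<close> in \<open>r\<close>.
\<close>

lemma has_d_rho_d_t:
  assumes F: "smooth_up_to_axis F" and \<rho>: "\<rho> \<in> {0<..<2}"
  shows "((\<lambda>r. d_t F r t) has_real_derivative d_t (d_rho F) \<rho> t) (at \<rho>)"
proof -
  note F\<rho> = smooth_up_to_axis_d_rho[OF F]
  \<comment> \<open>A compact interval around \<open>\<rho>\<close> that avoids both ends of \<open>(0, 2)\<close>, where all partial derivatives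
    are continuous.\<close>
  define a b where "a = \<rho> / 2" and "b = (\<rho> + 2) / 2"
  have ab: "0 < a" "a < \<rho>" "\<rho> < b" "b < 2"
    using \<rho> by (auto simp: a_def b_def)
  have cont: "continuous_on S (\<lambda>x. G (f x) (g x))"
    if "smooth_up_to_axis G" "continuous_on S f" "continuous_on S g" "f ` S \<subseteq> {a..b}"
    for G and S :: "'x::topological_space set" and f g
    using continuous_on_compose2[OF extends_to_axis_continuous_on[OF smooth_imp_extends_to_axis[OF that(1)]],
        of S "\<lambda>x. (f x, g x)"] that(2-) ab by (fastforce intro!: continuous_intros)
  have F_eq: "F r s = F a s + integral (cbox a r) (\<lambda>x. d_rho F x s)" if r: "r \<in> {a..b}" for r s
  proof -
    have "((\<lambda>x. d_rho F x s) has_integral (F r s - F a s)) {a..r}"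
    proof (rule fundamental_theorem_of_calculus)
      show "((\<lambda>x. F x s) has_vector_derivative d_rho F x s) (at x within {a..r})"
        if "x \<in> {a..r}" for x
        using that r ab has_d_rho[OF F, of x s]
        by (auto simp: has_real_derivative_iff_has_vector_derivative intro: has_vector_derivative_at_within)
    qed (use r in auto)
    then show ?thesis by (simp add: integral_unique)
  qed
  have dt_eq: "d_t F r t = d_t F a t + integral {a..r} (\<lambda>x. d_t (d_rho F) x t)" if r: "r \<in> {a..b}" for r
  proof -
    have "((\<lambda>s. integral (cbox a r) (\<lambda>x. d_rho F x s)) has_field_derivative
        integral (cbox a r) (\<lambda>x. d_t (d_rho F) x t)) (at t within UNIV)"
    proof (rule leibniz_rule_field_derivative)
      show "((\<lambda>s. d_rho F x s) has_field_derivative d_t (d_rho F) x s) (at s within UNIV)"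
        if "x \<in> cbox a r" for x s
        using that r ab by (auto intro!: has_d_t[OF F\<rho>])
      show "(\<lambda>x. d_rho F x s) integrable_on cbox a r" for s
        using r by (intro integrable_continuous cont[OF F\<rho>] continuous_intros) auto
      show "continuous_on (UNIV \<times> cbox a r) (\<lambda>(s, x). d_t (d_rho F) x s)"
        unfolding case_prod_unfold using r
        by (intro cont[OF smooth_up_to_axis_d_t[OF F\<rho>]] continuous_intros) auto
    qed auto
    moreover have "((\<lambda>s. F a s) has_field_derivative d_t F a t) (at t)"
      using ab by (intro has_d_t[OF F]) auto
    ultimately have "((\<lambda>s. F r s) has_field_derivative
        d_t F a t + integral (cbox a r) (\<lambda>x. d_t (d_rho F) x t)) (at t)"
      unfolding ext[OF F_eq[OF r]] by (intro DERIV_add) auto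
    moreover have "((\<lambda>s. F r s) has_field_derivative d_t F r t) (at t)"
      using r ab by (intro has_d_t[OF F]) auto
    ultimately show ?thesis by (metis DERIV_unique box_real(2))
  qed
  have "((\<lambda>r. integral {a..r} (\<lambda>x. d_t (d_rho F) x t)) has_real_derivative d_t (d_rho F) \<rho> t)
      (at \<rho> within {a..b})"
    using ab by (intro integral_has_real_derivative cont[OF smooth_up_to_axis_d_t[OF F\<rho>]] continuous_intros) auto
  then have "((\<lambda>r. d_t F a t + integral {a..r} (\<lambda>x. d_t (d_rho F) x t)) has_real_derivative d_t (d_rho F) \<rho> t)
      (at \<rho>)"
    using ab by (auto intro!: derivative_eq_intros simp: at_within_Icc_at)
  then show ?thesis
    by (rule has_field_derivative_transform_within_open[where S = "{a<..<b}"])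
      (use ab in \<open>auto simp flip: dt_eq\<close>)
qed

corollary d_rho_d_t_commute:
  "smooth_up_to_axis F \<Longrightarrow> \<rho> \<in> {0<..<2} \<Longrightarrow> d_rho (d_t F) \<rho> t = d_t (d_rho F) \<rho> t"
  unfolding d_rho_def[of "d_t F"] by (intro DERIV_imp_deriv has_d_rho_d_t)

section \<open>Behaviour at the axis and at the boundary\<close>

lemma extends_to_axis_powr_mult:
  assumes "extends_to_axis F"
  shows "extends_to_axis (\<lambda>\<rho> t. \<rho> powr p * F \<rho> t)"
proof -
  obtain G where G: "continuous_on ({0<..2} \<times> UNIV) G" "\<And>\<rho> t. \<rho> \<in> {0<..<2} \<Longrightarrow> G (\<rho>, t) = F \<rho> t"
    using assms unfolding extends_to_axis_def by blast
  have "continuous_on ({0<..2} \<times> UNIV) (\<lambda>x. fst x powr p * G x)"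
    by (intro continuous_intros G(1)) auto
  with G(2) show ?thesis unfolding extends_to_axis_def
    by (intro exI[of _ "\<lambda>x. fst x powr p * G x"]) auto
qed

lemma extends_to_axis_tendsto:
  assumes "extends_to_axis F"
  shows "\<exists>l. ((\<lambda>\<rho>. F \<rho> t) \<longlongrightarrow> l) (at_left 2)"
proof -
  obtain G where G: "continuous_on ({0<..2} \<times> UNIV) G" "\<And>\<rho> t. \<rho> \<in> {0<..<2} \<Longrightarrow> G (\<rho>, t) = F \<rho> t"
    using assms unfolding extends_to_axis_def by blast
  have "continuous_on {0<..2} (\<lambda>\<rho>. G (\<rho>, t))"
    by (rule continuous_on_compose2[OF G(1)]) (auto intro!: continuous_intros)
  then have "((\<lambda>\<rho>. G (\<rho>, t)) \<longlongrightarrow> G (2, t)) (at 2 within {0<..2})"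
    by (auto simp: continuous_on_def)
  then have "((\<lambda>\<rho>. G (\<rho>, t)) \<longlongrightarrow> G (2, t)) (at 2 within {0<..<2})"
    by (rule tendsto_within_subset) auto
  then have "((\<lambda>\<rho>. F \<rho> t) \<longlongrightarrow> G (2, t)) (at 2 within {0<..<2})"
    by (rule Lim_transform_eventually) (auto simp: eventually_at_filter G(2))
  moreover have "at 2 within {0<..<2} = at_left (2::real)"
    by (rule at_within_nhd[of _ "{0<..}"]) auto
  ultimately show ?thesis by auto
qed

text \<open>
  The two extensions are bounded on the compact sets \<open>[0,1] \<times> [c,d]\<close> and \<open>[1,2] \<times> [c,d]\<close>
  respectively.
\<close>

lemma bounded_on_slab:
  assumes "extends_to_zero F" "extends_to_axis F"
  obtains B where "B \<ge> 0" "\<And>\<rho> t. \<rho> \<in> {0<..<2} \<Longrightarrow> t \<in> {c..d} \<Longrightarrow> \<bar>F \<rho> t\<bar> \<le> B"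
proof -
  obtain G where G: "continuous_on ({0..<2} \<times> UNIV) G" "\<And>\<rho> t. \<rho> \<in> {0<..<2} \<Longrightarrow> G (\<rho>, t) = F \<rho> t"
    using assms(1) unfolding extends_to_zero_def by blast
  obtain H where H: "continuous_on ({0<..2} \<times> UNIV) H" "\<And>\<rho> t. \<rho> \<in> {0<..<2} \<Longrightarrow> H (\<rho>, t) = F \<rho> t"
    using assms(2) unfolding extends_to_axis_def by blast
  have "bounded (G ` ({0..1} \<times> {c..d}))"
    by (intro compact_imp_bounded compact_continuous_image continuous_on_subset[OF G(1)])
      (auto intro: compact_Times)
  then obtain B where B: "\<And>x. x \<in> {0..1} \<times> {c..d} \<Longrightarrow> \<bar>G x\<bar> \<le> B"
    unfolding bounded_iff by (metis imageI real_norm_def)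
  have "bounded (H ` ({1..2} \<times> {c..d}))"
    by (intro compact_imp_bounded compact_continuous_image continuous_on_subset[OF H(1)])
      (auto intro: compact_Times)
  then obtain C where C: "\<And>x. x \<in> {1..2} \<times> {c..d} \<Longrightarrow> \<bar>H x\<bar> \<le> C"
    unfolding bounded_iff by (metis imageI real_norm_def)
  show ?thesis
  proof (rule that[of "\<bar>B\<bar> + \<bar>C\<bar>"])
    show "\<bar>F \<rho> t\<bar> \<le> \<bar>B\<bar> + \<bar>C\<bar>" if "\<rho> \<in> {0<..<2}" "t \<in> {c..d}" for \<rho> t
      using B[of "(\<rho>, t)"] C[of "(\<rho>, t)"] G(2)[of \<rho> t] H(2)[of \<rho> t] that by (cases "\<rho> \<le> 1") auto
  qed simp
qed

text \<open>
  Near \<open>(0, t)\<close> the function \<open>\<partial>\<^sub>tF\<close> is within \<open>e\<close> of its boundary value \<open>D\<close>.  The mean value inequality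
  turns this into a bound on the difference quotients of \<open>F(\<rho>, \<cdot>)\<close> that is uniform in small \<open>\<rho>\<close>, and
  therefore survives the passage to the trace.
\<close>

lemma boundary_trace_derivative:
  assumes F: "smooth_up_to_axis F" and zero: "extends_to_zero (d_t F)"
    and trace: "\<And>t. ((\<lambda>\<rho>. F \<rho> t) \<longlongrightarrow> v t) (at_right 0)"
  obtains D where "(v has_real_derivative D) (at t)" "((\<lambda>\<rho>. d_t F \<rho> t) \<longlongrightarrow> D) (at_right 0)"
proof -
  obtain G where G: "continuous_on ({0..<2} \<times> UNIV) G"
      "\<And>\<rho> t. \<rho> \<in> {0<..<2} \<Longrightarrow> G (\<rho>, t) = d_t F \<rho> t"
    using zero unfolding extends_to_zero_def by blast
  define D where "D = G (0, t)"
  have near: "\<exists>d>0. d < 2 \<and> (\<forall>\<rho> s. 0 < \<rho> \<longrightarrow> \<rho> < d \<longrightarrow> \<bar>s - t\<bar> < d \<longrightarrow> \<bar>d_t F \<rho> s - D\<bar> \<le> e)"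
    if "e > 0" for e
  proof -
    obtain d where d: "d > 0"
      and *: "\<And>x. x \<in> {0..<2} \<times> UNIV \<Longrightarrow> dist x (0, t) < d \<Longrightarrow> dist (G x) (G (0, t)) < e"
      using G(1) \<open>e > 0\<close> unfolding continuous_on_iff by fastforce
    show ?thesis
    proof (intro exI[of _ "min (d / 2) 1"] conjI allI impI)
      fix \<rho> s assume A: "0 < \<rho>" "\<rho> < min (d / 2) 1" "\<bar>s - t\<bar> < min (d / 2) 1"
      have "dist (\<rho>, s) (0, t) \<le> \<bar>\<rho>\<bar> + \<bar>s - t\<bar>"
        unfolding dist_Pair_Pair dist_real_def using sqrt_sum_squares_le_sum_abs[of "\<rho> - 0" "s - t"] by simp
      also have "\<dots> < d" using A by auto
      finally show "\<bar>d_t F \<rho> s - D\<bar> \<le> e"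
        using *[of "(\<rho>, s)"] A by (auto simp: dist_real_def G(2) D_def)
    qed (use d in auto)
  qed
  have "((\<lambda>\<rho>. d_t F \<rho> t) \<longlongrightarrow> D) (at_right 0)"
  proof (rule tendstoI)
    fix e :: real assume "e > 0"
    then obtain d where "d > 0" and d: "\<And>\<rho>. 0 < \<rho> \<Longrightarrow> \<rho> < d \<Longrightarrow> \<bar>d_t F \<rho> t - D\<bar> \<le> e / 2"
      using near[of "e / 2"] by (metis abs_zero diff_self half_gt_zero)
    have "dist (d_t F \<rho> t) D < e" if "0 < \<rho>" "\<rho> < d" for \<rho>
      using d[OF that] \<open>e > 0\<close> by (simp add: dist_real_def)
    with \<open>d > 0\<close> show "\<forall>\<^sub>F \<rho> in at_right 0. dist (d_t F \<rho> t) D < e"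
      by (auto simp: eventually_at_right_field)
  qed
  moreover have "((\<lambda>h. (v (t + h) - v t) / h) \<longlongrightarrow> D) (at 0)"
  proof (rule tendstoI)
    fix e :: real assume e: "e > 0"
    then obtain d where d: "d > 0" "d < 2"
      and *: "\<And>\<rho> s. 0 < \<rho> \<Longrightarrow> \<rho> < d \<Longrightarrow> \<bar>s - t\<bar> < d \<Longrightarrow> \<bar>d_t F \<rho> s - D\<bar> \<le> e / 2"
      using near[of "e / 2"] by auto
    have "dist ((v (t + h) - v t) / h) D < e" if h: "h \<noteq> 0" "\<bar>h\<bar> < d" for h
    proof -
      have "\<bar>(F \<rho> (t + h) - F \<rho> t) / h - D\<bar> \<le> e / 2" if \<rho>: "0 < \<rho>" "\<rho> < d" for \<rho>
      proof -
        have "norm ((F \<rho> (t + h) - D * (t + h)) - (F \<rho> t - D * t)) \<le> e / 2 * norm (t + h - t)"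
        proof (rule field_differentiable_bound[of "closed_segment t (t + h)"])
          fix s assume s: "s \<in> closed_segment t (t + h)"
          show "((\<lambda>s. F \<rho> s - D * s) has_field_derivative d_t F \<rho> s - D)
              (at s within closed_segment t (t + h))"
            using \<rho> d by (auto intro!: derivative_eq_intros
                has_field_derivative_at_within[OF has_d_t[OF F]])
          have "\<bar>s - t\<bar> \<le> \<bar>h\<bar>"
            using s by (auto simp: closed_segment_eq_real_ivl split: if_splits)
          with h \<rho> show "norm (d_t F \<rho> s - D) \<le> e / 2"
            using *[of \<rho> s] by simp
        qed auto
        then have "\<bar>F \<rho> (t + h) - F \<rho> t - D * h\<bar> \<le> e / 2 * \<bar>h\<bar>"
          by (simp add: algebra_simps)
        then have "\<bar>(F \<rho> (t + h) - F \<rho> t - D * h) / h\<bar> \<le> e / 2"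
          using h by (simp add: abs_divide divide_le_eq)
        then show ?thesis using h by (simp add: diff_divide_distrib)
      qed
      then have "\<forall>\<^sub>F \<rho> in at_right 0. \<bar>(F \<rho> (t + h) - F \<rho> t) / h - D\<bar> \<le> e / 2"
        using d by (auto simp: eventually_at_right_field)
      moreover have "((\<lambda>\<rho>. \<bar>(F \<rho> (t + h) - F \<rho> t) / h - D\<bar>) \<longlongrightarrow> \<bar>(v (t + h) - v t) / h - D\<bar>) (at_right 0)"
        using h by (intro tendsto_intros trace) auto
      ultimately have "\<bar>(v (t + h) - v t) / h - D\<bar> \<le> e / 2"
        by (intro tendsto_upperbound) auto
      with e show ?thesis by (simp add: dist_real_def)
    qed
    then show "\<forall>\<^sub>F h in at 0. dist ((v (t + h) - v t) / h) D < e"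
      using d by (auto simp: eventually_at intro!: exI[of _ d])
  qed
  ultimately show ?thesis
    by (intro that[of D]) (auto simp: DERIV_def)
qed

section \<open>The energy form\<close>

text \<open>
  The polarisation of \<open>ham_integrand\<close>.  Its bilinearity is what makes the Hamiltonian and its time
  derivative two instances, \<open>(V, V)\<close> and \<open>(V, \<partial>\<^sub>tV)\<close>, of the same estimates.
\<close>

definition energy_form ::
    "nat \<Rightarrow> real \<Rightarrow> (real \<Rightarrow> real \<Rightarrow> real) \<Rightarrow> (real \<Rightarrow> real \<Rightarrow> real) \<Rightarrow> real \<Rightarrow> real \<Rightarrow> real" where
  "energy_form n \<gamma> F G t \<rho> = \<rho> powr a_exp \<gamma> *
     (e1_coef n \<rho> * (d_t F \<rho> t * d_t G \<rho> t) - e_coef n \<rho> * (d_rho F \<rho> t * d_rho G \<rho> t)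
       - e2_coef n \<gamma> \<rho> * (F \<rho> t * G \<rho> t))"

text \<open>
  The part of the regularity of a solution \<open>V\<close> that bounds the energy.  It is chosen so that
  \<open>regular_up_to_boundary\<close> yields it both for \<open>V\<close> and for \<open>\<partial>\<^sub>tV\<close>.
\<close>

definition finite_energy :: "real \<Rightarrow> (real \<Rightarrow> real \<Rightarrow> real) \<Rightarrow> bool" where
  "finite_energy \<gamma> F \<longleftrightarrow> smooth_up_to_axis F \<and> extends_to_zero F \<and> extends_to_zero (d_t F) \<and>
     extends_to_zero (\<lambda>\<rho> t. \<rho> powr a_exp \<gamma> * d_rho F \<rho> t)"

lemma ham_integrand_eq: "ham_integrand n \<gamma> V t = energy_form n \<gamma> V V t"
  by (simp add: fun_eq_iff ham_integrand_def energy_form_def power2_eq_square)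

lemma continuous_on_coefs [continuous_intros]:
  "continuous_on S (e_coef n)" "continuous_on S (e1_coef n)" "continuous_on S (e2_coef n \<gamma>)"
proof -
  have "1 + x\<^sup>2 / 4 \<noteq> 0" for x :: real
    by (metis add_pos_nonneg divide_nonneg_pos less_numeral_extra(1,3) zero_le_power2 zero_less_numeral)
  then show "continuous_on S (e_coef n)" "continuous_on S (e1_coef n)" "continuous_on S (e2_coef n \<gamma>)"
    unfolding e_coef_def[abs_def] e1_coef_def[abs_def] e2_coef_def[abs_def]
    by (auto intro!: continuous_intros)
qed

lemma bounded_on_interval:
  fixes f :: "real \<Rightarrow> real"
  assumes "continuous_on {0..2} f"
  obtains K where "K \<ge> 0" "\<And>x. x \<in> {0<..<2} \<Longrightarrow> \<bar>f x\<bar> \<le> K"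
proof -
  have "bounded (f ` {0..2})"
    by (intro compact_imp_bounded compact_continuous_image assms) auto
  then obtain K where K: "\<And>x. x \<in> {0..2} \<Longrightarrow> \<bar>f x\<bar> \<le> K"
    unfolding bounded_iff by (metis imageI real_norm_def)
  have "K \<ge> 0" using K[of 0] by simp
  with K show ?thesis by (intro that[of K]) auto
qed

text \<open>
  All factors but the \<open>\<rho>\<close>-derivatives are bounded, which accounts for the weight \<open>\<rho>\<^sup>a\<close>.  For the
  \<open>\<rho>\<close>-derivatives only \<open>\<rho>\<^sup>a \<partial>\<^sub>\<rho>F\<close> and \<open>\<rho>\<^sup>a \<partial>\<^sub>\<rho>G\<close> are bounded, so their product is written as
  \<open>\<rho>\<^sup>a \<partial>\<^sub>\<rho>F \<partial>\<^sub>\<rho>G = \<rho>\<^sup>-\<^sup>a (\<rho>\<^sup>a \<partial>\<^sub>\<rho>F) (\<rho>\<^sup>a \<partial>\<^sub>\<rho>G)\<close>, at the price of the weight \<open>\<rho>\<^sup>-\<^sup>a\<close>.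
\<close>

lemma energy_form_bound:
  assumes F: "finite_energy \<gamma> F" and G: "finite_energy \<gamma> G"
  obtains M where "\<And>\<rho> t. \<rho> \<in> {0<..<2} \<Longrightarrow> t \<in> {c..d} \<Longrightarrow>
    \<bar>energy_form n \<gamma> F G t \<rho>\<bar> \<le> M * (\<rho> powr a_exp \<gamma> + \<rho> powr - a_exp \<gamma>)"
proof -
  have *: "\<exists>B\<ge>0. \<forall>\<rho>\<in>{0<..<2}. \<forall>t\<in>{c..d}. \<bar>H \<rho> t\<bar> \<le> B \<and> \<bar>d_t H \<rho> t\<bar> \<le> B \<and>
      \<bar>\<rho> powr a_exp \<gamma> * d_rho H \<rho> t\<bar> \<le> B" if H: "finite_energy \<gamma> H" for H
  proof -
    have sm: "smooth_up_to_axis H" and z: "extends_to_zero H" "extends_to_zero (d_t H)"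
      "extends_to_zero (\<lambda>\<rho> t. \<rho> powr a_exp \<gamma> * d_rho H \<rho> t)"
      using H by (auto simp: finite_energy_def)
    obtain B1 where B1: "B1 \<ge> 0" "\<And>\<rho> t. \<rho> \<in> {0<..<2} \<Longrightarrow> t \<in> {c..d} \<Longrightarrow> \<bar>H \<rho> t\<bar> \<le> B1"
      using bounded_on_slab[OF z(1) smooth_imp_extends_to_axis[OF sm]] by metis
    obtain B2 where B2: "B2 \<ge> 0" "\<And>\<rho> t. \<rho> \<in> {0<..<2} \<Longrightarrow> t \<in> {c..d} \<Longrightarrow> \<bar>d_t H \<rho> t\<bar> \<le> B2"
      using bounded_on_slab[OF z(2) smooth_imp_extends_to_axis[OF smooth_up_to_axis_d_t[OF sm]]]
      by metis
    obtain B3 where B3: "B3 \<ge> 0" "\<And>\<rho> t. \<rho> \<in> {0<..<2} \<Longrightarrow> t \<in> {c..d} \<Longrightarrow>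
        \<bar>\<rho> powr a_exp \<gamma> * d_rho H \<rho> t\<bar> \<le> B3"
      using bounded_on_slab[OF z(3) extends_to_axis_powr_mult[OF
          smooth_imp_extends_to_axis[OF smooth_up_to_axis_d_rho[OF sm]]]] by metis
    show ?thesis
    proof (intro exI[of _ "B1 + B2 + B3"] conjI ballI)
      fix \<rho> t :: real assume "\<rho> \<in> {0<..<2}" "t \<in> {c..d}"
      with B1 B2 B3 show "\<bar>H \<rho> t\<bar> \<le> B1 + B2 + B3" "\<bar>d_t H \<rho> t\<bar> \<le> B1 + B2 + B3"
        "\<bar>\<rho> powr a_exp \<gamma> * d_rho H \<rho> t\<bar> \<le> B1 + B2 + B3"
        by (smt (verit))+
    qed (use B1(1) B2(1) B3(1) in simp)
  qed
  obtain B where B: "B \<ge> 0" "\<And>\<rho> t. \<rho> \<in> {0<..<2} \<Longrightarrow> t \<in> {c..d} \<Longrightarrow> \<bar>F \<rho> t\<bar> \<le> B \<and> \<bar>d_t F \<rho> t\<bar> \<le> B \<and>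
      \<bar>\<rho> powr a_exp \<gamma> * d_rho F \<rho> t\<bar> \<le> B"
    using *[OF F] by blast
  obtain C where C: "C \<ge> 0" "\<And>\<rho> t. \<rho> \<in> {0<..<2} \<Longrightarrow> t \<in> {c..d} \<Longrightarrow> \<bar>G \<rho> t\<bar> \<le> C \<and> \<bar>d_t G \<rho> t\<bar> \<le> C \<and>
      \<bar>\<rho> powr a_exp \<gamma> * d_rho G \<rho> t\<bar> \<le> C"
    using *[OF G] by blast
  obtain K0 where K0: "K0 \<ge> 0" "\<And>x. x \<in> {0<..<2} \<Longrightarrow> \<bar>e_coef n x\<bar> \<le> K0"
    using bounded_on_interval[OF continuous_on_coefs(1)] by blast
  obtain K1 where K1: "K1 \<ge> 0" "\<And>x. x \<in> {0<..<2} \<Longrightarrow> \<bar>e1_coef n x\<bar> \<le> K1"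
    using bounded_on_interval[OF continuous_on_coefs(2)] by blast
  obtain K2 where K2: "K2 \<ge> 0" "\<And>x. x \<in> {0<..<2} \<Longrightarrow> \<bar>e2_coef n \<gamma> x\<bar> \<le> K2"
    using bounded_on_interval[OF continuous_on_coefs(3)] by blast
  show ?thesis
  proof (rule that[of "(K0 + K1 + K2) * (B * C)"])
    fix \<rho> t :: real assume \<rho>: "\<rho> \<in> {0<..<2}" and t: "t \<in> {c..d}"
    define w where "w = \<rho> powr a_exp \<gamma>"
    have w: "w > 0" "\<rho> powr - a_exp \<gamma> = inverse w"
      using \<rho> by (auto simp: w_def powr_minus)
    have prod: "\<bar>k * (x * y)\<bar> \<le> K * (B * C)"
      if "\<bar>k\<bar> \<le> K" "\<bar>x\<bar> \<le> B" "\<bar>y\<bar> \<le> C" for k x y K :: real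
      unfolding abs_mult using that B(1) C(1) by (intro mult_mono) auto
    have 1: "\<bar>e1_coef n \<rho> * (d_t F \<rho> t * d_t G \<rho> t)\<bar> \<le> K1 * (B * C)"
      and 2: "\<bar>e2_coef n \<gamma> \<rho> * (F \<rho> t * G \<rho> t)\<bar> \<le> K2 * (B * C)"
      and 3: "\<bar>e_coef n \<rho> * ((w * d_rho F \<rho> t) * (w * d_rho G \<rho> t))\<bar> \<le> K0 * (B * C)"
      using B(2)[OF \<rho> t] C(2)[OF \<rho> t] K0(2)[OF \<rho>] K1(2)[OF \<rho>] K2(2)[OF \<rho>]
      by (auto intro!: prod simp: w_def)
    have "energy_form n \<gamma> F G t \<rho> =
        w * (e1_coef n \<rho> * (d_t F \<rho> t * d_t G \<rho> t) - e2_coef n \<gamma> \<rho> * (F \<rho> t * G \<rho> t))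
        - inverse w * (e_coef n \<rho> * ((w * d_rho F \<rho> t) * (w * d_rho G \<rho> t)))"
      using w(1) by (simp add: energy_form_def w_def[symmetric] field_simps)
    also have "\<bar>\<dots>\<bar> \<le> w * ((K1 + K2) * (B * C)) + inverse w * (K0 * (B * C))"
    proof (rule order_trans[OF abs_triangle_ineq4], rule add_mono)
      show "\<bar>w * (e1_coef n \<rho> * (d_t F \<rho> t * d_t G \<rho> t) - e2_coef n \<gamma> \<rho> * (F \<rho> t * G \<rho> t))\<bar>
          \<le> w * ((K1 + K2) * (B * C))"
        using 1 2 w(1) by (auto simp: abs_mult[of w] distrib_right intro!: mult_left_mono)
      show "\<bar>inverse w * (e_coef n \<rho> * ((w * d_rho F \<rho> t) * (w * d_rho G \<rho> t)))\<bar>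
          \<le> inverse w * (K0 * (B * C))"
        using 3 w(1) by (auto simp: abs_mult[of "inverse w"] intro!: mult_left_mono)
    qed
    also have "\<dots> \<le> (K0 + K1 + K2) * (B * C) * (w + inverse w)"
      using w(1) B(1) C(1) K0(1) K1(1) K2(1) by (simp add: algebra_simps)
    finally show "\<bar>energy_form n \<gamma> F G t \<rho>\<bar> \<le>
        (K0 + K1 + K2) * (B * C) * (\<rho> powr a_exp \<gamma> + \<rho> powr - a_exp \<gamma>)"
      by (simp add: w(2) w_def[symmetric])
  qed
qed

lemma continuous_on_energy_form:
  assumes "smooth_up_to_axis F" "smooth_up_to_axis G"
  shows "continuous_on {0<..<2} (energy_form n \<gamma> F G t)"
proof -
  have "continuous_on {0<..<2} (\<lambda>\<rho>. H \<rho> t)" if "smooth_up_to_axis H" for H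
    using DERIV_isCont[OF has_d_rho[OF that]] by (intro continuous_at_imp_continuous_on) blast
  then show ?thesis
    unfolding energy_form_def[abs_def] using assms
    by (intro continuous_intros) (auto simp: smooth_up_to_axis_d_rho smooth_up_to_axis_d_t)
qed

lemma set_integrable_weight:
  assumes "0 < \<gamma>" "\<gamma> < 1"
  shows "set_integrable lborel {0<..<2} (\<lambda>\<rho>. M * (\<rho> powr a_exp \<gamma> + \<rho> powr - a_exp \<gamma>))"
  using assms by (intro set_integrable_mult_right set_integral_add(1) set_integrable_powr_interval)
    (auto simp: a_exp_def)

lemma set_integrable_energy_form:
  assumes \<gamma>: "0 < \<gamma>" "\<gamma> < 1" and F: "finite_energy \<gamma> F" and G: "finite_energy \<gamma> G"
  shows "set_integrable lborel {0<..<2} (energy_form n \<gamma> F G t)"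
proof -
  obtain M where M: "\<And>\<rho> s. \<rho> \<in> {0<..<2} \<Longrightarrow> s \<in> {t..t} \<Longrightarrow>
      \<bar>energy_form n \<gamma> F G s \<rho>\<bar> \<le> M * (\<rho> powr a_exp \<gamma> + \<rho> powr - a_exp \<gamma>)"
    using energy_form_bound[OF F G] by metis
  show ?thesis
  proof (rule set_integrable_bound[OF set_integrable_weight[OF \<gamma>, of M]])
    have "continuous_on {0<..<2} (energy_form n \<gamma> F G t)"
      using F G by (intro continuous_on_energy_form) (auto simp: finite_energy_def)
    then show "set_borel_measurable lborel {0<..<2} (energy_form n \<gamma> F G t)"
      unfolding set_borel_measurable_def
      using borel_measurable_continuous_on_indicator[of "{0<..<2::real}" "energy_form n \<gamma> F G t"] by simp
    show "AE \<rho> in lborel. \<rho> \<in> {0<..<2} \<longrightarrow> norm (energy_form n \<gamma> F G t \<rho>)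
        \<le> norm (M * (\<rho> powr a_exp \<gamma> + \<rho> powr - a_exp \<gamma>))"
      using M[of _ t] by (intro AE_I2) (auto intro: order_trans[OF _ abs_ge_self])
  qed
qed

text \<open>
  The factor 2 is the symmetry of the form; the derivative of its \<open>\<rho>\<close>-part is \<open>\<partial>\<^sub>t\<partial>\<^sub>\<rho>F\<close>, which has to be
  recognised as the \<open>\<rho>\<close>-derivative of \<open>\<partial>\<^sub>tF\<close>.
\<close>

lemma energy_form_has_derivative:
  assumes F: "smooth_up_to_axis F" and \<rho>: "\<rho> \<in> {0<..<2}"
  shows "((\<lambda>s. energy_form n \<gamma> F F s \<rho>) has_real_derivative 2 * energy_form n \<gamma> F (d_t F) t \<rho>) (at t)"
proof -
  show ?thesis
    unfolding energy_form_def
    by (auto intro!: derivative_eq_intros has_d_t[OF F \<rho>] has_d_t[OF smooth_up_to_axis_d_t[OF F] \<rho>]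
        has_d_t[OF smooth_up_to_axis_d_rho[OF F] \<rho>] simp: d_rho_d_t_commute[OF F \<rho>] algebra_simps)
qed

section \<open>Conservation of the Hamiltonian\<close>

text \<open>
  The extension equation multiplied by \<open>e\<close>, via \<open>e / (1 + \<rho>\<^sup>2/4)\<^sup>2 = e\<^sub>1\<close> and \<open>e E = \<rho>\<^sup>a e\<^sub>2\<close>.  The second
  identity cancels the pole of \<open>E\<close> at \<open>\<rho> = 2\<close> against one factor of \<open>(1 - \<rho>\<^sup>2/4)\<^sup>n\<^sup>-\<^sup>1\<close>, available
  as \<open>n \<ge> 2\<close>.
\<close>

lemma conormal_derivative_equation:
  assumes n: "n \<ge> 2" and V: "smooth_up_to_axis V" and \<rho>: "\<rho> \<in> {0<..<2}"
    and eq: "- weighted_div_grad n \<gamma> V \<rho> t + E_coef n \<gamma> \<rho> * V \<rho> t = 0"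
  shows "((\<lambda>r. r powr a_exp \<gamma> * e_coef n r * d_rho V r t) has_real_derivative
    \<rho> powr a_exp \<gamma> * (e2_coef n \<gamma> \<rho> * V \<rho> t - e1_coef n \<rho> * d_t (d_t V) \<rho> t)) (at \<rho>)"
    (is "(?f has_real_derivative _) _")
proof -
  have "e_coef n field_differentiable at \<rho>"
    unfolding e_coef_def[abs_def] by (intro derivative_intros) auto
  then obtain D where "(e_coef n has_real_derivative D) (at \<rho>)"
    by (auto simp: field_differentiable_def)
  moreover have "((\<lambda>r. r powr a_exp \<gamma>) has_real_derivative a_exp \<gamma> * \<rho> powr (a_exp \<gamma> - 1)) (at \<rho>)"
    using \<rho> by (intro has_real_derivative_powr) auto
  ultimately have "\<exists>D. (?f has_real_derivative D) (at \<rho>)"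
    using DERIV_mult[OF DERIV_mult has_d_rho[OF smooth_up_to_axis_d_rho[OF V] \<rho>]] by blast
  then have f: "(?f has_real_derivative d_rho (\<lambda>r s. r powr a_exp \<gamma> * e_coef n r * d_rho V r s) \<rho> t) (at \<rho>)"
    unfolding d_rho_def[of "\<lambda>r s. r powr a_exp \<gamma> * e_coef n r * d_rho V r s"]
    using DERIV_imp_deriv by blast
  define W where "W = d_rho (\<lambda>r s. r powr a_exp \<gamma> * e_coef n r * d_rho V r s) \<rho> t"
  define x where "x = \<rho>\<^sup>2 / 4"
  have "\<rho>\<^sup>2 < 2\<^sup>2"
    using \<rho> by (intro power_strict_mono) auto
  then have x: "0 \<le> x" "x < 1" by (auto simp: x_def)
  obtain m where m: "n = 2 + m"
    using le_Suc_ex[OF n] ..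
  have "(\<lambda>s. d_t V \<rho> s) field_differentiable at t"
    using has_d_t[OF smooth_up_to_axis_d_t[OF V] \<rho>] by (auto simp: field_differentiable_def)
  then have "- (1 / e_coef n \<rho>) * W - \<rho> powr a_exp \<gamma> / (1 + x)\<^sup>2 * d_t (d_t V) \<rho> t
      + E_coef n \<gamma> \<rho> * V \<rho> t = 0"
    using eq weighted_div_grad_eq[of \<rho> V t n \<gamma>] \<rho> by (simp add: W_def x_def)
  then have "W / e_coef n \<rho> = E_coef n \<gamma> \<rho> * V \<rho> t - \<rho> powr a_exp \<gamma> / (1 + x)\<^sup>2 * d_t (d_t V) \<rho> t"
    by simp
  moreover have "e_coef n \<rho> \<noteq> 0"
    using x by (simp add: e_coef_def x_def[symmetric])
  ultimately have "W = e_coef n \<rho> * (E_coef n \<gamma> \<rho> * V \<rho> t - \<rho> powr a_exp \<gamma> / (1 + x)\<^sup>2 * d_t (d_t V) \<rho> t)"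
    by (metis mult.commute nonzero_divide_eq_eq)
  also have "\<dots> = (e_coef n \<rho> * E_coef n \<gamma> \<rho>) * V \<rho> t
      - \<rho> powr a_exp \<gamma> * (e_coef n \<rho> / (1 + x)\<^sup>2) * d_t (d_t V) \<rho> t"
    by (simp add: right_diff_distrib)
  also have "e_coef n \<rho> / (1 + x)\<^sup>2 = e1_coef n \<rho>"
    using x unfolding e_coef_def e1_coef_def x_def[symmetric]
    by (simp add: power2_eq_square divide_simps)
  also have "e_coef n \<rho> * E_coef n \<gamma> \<rho> = \<rho> powr a_exp \<gamma> * e2_coef n \<gamma> \<rho>"
    using x unfolding e_coef_def E_coef_def e2_coef_def x_def[symmetric]
    by (simp add: m divide_simps) (simp add: algebra_simps)
  finally have "W = \<rho> powr a_exp \<gamma> * (e2_coef n \<gamma> \<rho> * V \<rho> t - e1_coef n \<rho> * d_t (d_t V) \<rho> t)"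
    by (simp add: right_diff_distrib mult.assoc)
  with f show ?thesis by (simp add: W_def)
qed

text \<open>
  By the equation, \<open>\<partial>\<^sub>\<rho>(\<rho>\<^sup>a e \<partial>\<^sub>\<rho>V \<cdot> \<partial>\<^sub>tV) = \<rho>\<^sup>a (e\<^sub>2 V - e\<^sub>1 \<partial>\<^sub>t\<^sub>tV) \<partial>\<^sub>tV + \<rho>\<^sup>a e \<partial>\<^sub>\<rho>V \<partial>\<^sub>\<rho>\<partial>\<^sub>tV\<close>, which
  is minus the energy form of \<open>V\<close> and \<open>\<partial>\<^sub>tV\<close>.  Only the flux through \<open>\<rho> = 0\<close> survives the integration,
  because \<open>e(2) = 0\<close>; there \<open>e(0) = 1\<close>.
\<close>

lemma integral_energy_form_d_t:
  assumes n: "n \<ge> 2" and \<gamma>: "0 < \<gamma>" "\<gamma> < 1"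
    and V: "finite_energy \<gamma> V" and Vt: "finite_energy \<gamma> (d_t V)"
    and eq: "\<And>\<rho>. \<rho> \<in> {0<..<2} \<Longrightarrow> - weighted_div_grad n \<gamma> V \<rho> t + E_coef n \<gamma> \<rho> * V \<rho> t = 0"
    and L: "((\<lambda>\<rho>. \<rho> powr a_exp \<gamma> * d_rho V \<rho> t) \<longlongrightarrow> L) (at_right 0)"
    and D: "((\<lambda>\<rho>. d_t V \<rho> t) \<longlongrightarrow> D) (at_right 0)"
  shows "(LINT \<rho>:{0<..<2}|lborel. energy_form n \<gamma> V (d_t V) t \<rho>) = L * D"
proof -
  define flux where "flux \<rho> = (\<rho> powr a_exp \<gamma> * e_coef n \<rho> * d_rho V \<rho> t) * d_t V \<rho> t" for \<rho>
  have sm: "smooth_up_to_axis V" "smooth_up_to_axis (d_t V)"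
    using V Vt by (auto simp: finite_energy_def)
  have e_lim: "(e_coef n \<longlongrightarrow> e_coef n x) (at x within S)" for x S
    using continuous_on_coefs(1)[of UNIV n] by (auto simp: continuous_on_def intro: tendsto_within_subset)
  have "(LINT \<rho>:{0<..<2}|lborel. - energy_form n \<gamma> V (d_t V) t \<rho>) = 0 - L * D"
  proof (rule set_integral_FTC_Ioo)
    fix \<rho> :: real assume \<rho>: "\<rho> \<in> {0<..<2}"
    show "(flux has_real_derivative - energy_form n \<gamma> V (d_t V) t \<rho>) (at \<rho>)"
      unfolding flux_def[abs_def]
      by (rule DERIV_cong[OF DERIV_mult[OF conormal_derivative_equation[OF n sm(1) \<rho> eq[OF \<rho>]]
            has_d_rho[OF sm(2) \<rho>]]]) (simp add: energy_form_def algebra_simps)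
  next
    have "((\<lambda>\<rho>. e_coef n \<rho> * (\<rho> powr a_exp \<gamma> * d_rho V \<rho> t) * d_t V \<rho> t)
        \<longlongrightarrow> e_coef n 0 * L * D) (at_right 0)"
      by (intro tendsto_intros e_lim L D)
    then show "(flux \<longlongrightarrow> L * D) (at_right 0)"
      by (simp add: flux_def[abs_def] e_coef_def[of _ 0] ac_simps)
  next
    obtain l m where "((\<lambda>\<rho>. d_rho V \<rho> t) \<longlongrightarrow> l) (at_left 2)" "((\<lambda>\<rho>. d_t V \<rho> t) \<longlongrightarrow> m) (at_left 2)"
      using extends_to_axis_tendsto smooth_imp_extends_to_axis smooth_up_to_axis_d_rho sm by metis
    then have "(flux \<longlongrightarrow> (2 powr a_exp \<gamma> * e_coef n 2 * l) * m) (at_left 2)"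
      unfolding flux_def by (intro tendsto_intros e_lim) auto
    \<comment> \<open>For \<open>n = 1\<close> the factor would be \<open>0 ^ 0 = 1\<close>, and flux could leave through the axis.\<close>
    moreover have "e_coef n 2 = 0" using n by (simp add: e_coef_def)
    ultimately show "(flux \<longlongrightarrow> 0) (at_left 2)" by simp
  next
    show "continuous_on {0<..<2} (\<lambda>\<rho>. - energy_form n \<gamma> V (d_t V) t \<rho>)"
      by (intro continuous_intros continuous_on_energy_form sm)
    show "set_integrable lborel {0<..<2} (\<lambda>\<rho>. - energy_form n \<gamma> V (d_t V) t \<rho>)"
      using set_integrable_energy_form[OF \<gamma> V Vt] by (simp add: set_integrable_def)
  qed simp
  then show ?thesis by (simp add: set_lebesgue_integral_def)
qed

lemma d_tilde_nonzero:
  assumes "0 < \<gamma>" "\<gamma> < 1"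
  shows "d_tilde \<gamma> \<noteq> 0"
proof -
  have "- \<gamma> \<noteq> real_of_int k" for k
  proof
    assume "- \<gamma> = real_of_int k"
    with assms have "real_of_int (- 1) < real_of_int k" "real_of_int k < real_of_int 0"
      by auto
    then show False unfolding of_int_less_iff by simp
  qed
  then have "- \<gamma> \<notin> \<int>\<^sub>\<le>\<^sub>0"
    by (auto elim!: nonpos_Ints_cases)
  then have "Gamma (- \<gamma>) \<noteq> 0" by (simp add: Gamma_eq_zero_iff)
  then show ?thesis using assms less_imp_neq[OF Gamma_real_pos[OF assms(1)]] by (simp add: d_tilde_def)
qed

theorem theorem1p2:
  fixes n :: nat and \<gamma> :: real
    and V :: "real \<Rightarrow> real \<Rightarrow> real" and v :: "real \<Rightarrow> real"
  assumes n: "n \<ge> 2" and \<gamma>: "0 < \<gamma>" "\<gamma> < 1"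
    and pos: "\<And>\<rho> t. 0 < \<rho> \<Longrightarrow> \<rho> < 2 \<Longrightarrow> V \<rho> t > 0"
    and smooth: "smooth_up_to_axis V"
    and regular: "regular_up_to_boundary \<gamma> V"
    and smooth_v: "smooth_on UNIV v"
    and equation: "\<And>\<rho> t. 0 < \<rho> \<Longrightarrow> \<rho> < 2 \<Longrightarrow>
        - weighted_div_grad n \<gamma> V \<rho> t + E_coef n \<gamma> \<rho> * V \<rho> t = 0"
    and dirichlet: "\<And>t. ((\<lambda>\<rho>. V \<rho> t) \<longlongrightarrow> v t) (at_right 0)"
    and neumann: "\<And>t. \<exists>L. ((\<lambda>\<rho>. \<rho> powr a_exp \<gamma> * d_rho V \<rho> t) \<longlongrightarrow> L) (at_right 0) \<and>
        - d_tilde \<gamma> * L = c_const n \<gamma> * v t powr ((real n + 2 * \<gamma>) / (real n - 2 * \<gamma>))"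
  shows "(\<forall>t. set_integrable lborel {0<..<2} (ham_integrand n \<gamma> V t)) \<and>
    hamiltonian n \<gamma> V v constant_on UNIV"
proof -
  have fin: "finite_energy \<gamma> V"
    using smooth regular by (simp add: finite_energy_def regular_up_to_boundary_def)
  have fin_t: "finite_energy \<gamma> (d_t V)"
    using smooth_up_to_axis_d_t[OF smooth] regular d_rho_d_t_commute[OF smooth]
    unfolding finite_energy_def regular_up_to_boundary_def extends_to_zero_def by simp
  have int: "set_integrable lborel {0<..<2} (energy_form n \<gamma> V V t)" for t
    by (rule set_integrable_energy_form[OF \<gamma> fin fin])
  have v_nonneg: "v t \<ge> 0" for t
  proof (rule tendsto_lowerbound[OF dirichlet])
    show "\<forall>\<^sub>F \<rho> in at_right 0. 0 \<le> V \<rho> t"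
      using pos by (auto simp: eventually_at_right_field less_imp_le intro!: exI[of _ 2])
  qed simp
  define p where "p = 2 * real n / (real n - 2 * \<gamma>)"
  have np: "real n - 2 * \<gamma> > 0" using n \<gamma> by linarith
  have p: "p > 1" "p - 1 = (real n + 2 * \<gamma>) / (real n - 2 * \<gamma>)"
    using np n \<gamma> by (auto simp: p_def field_simps)
  have "(hamiltonian n \<gamma> V v has_real_derivative 0) (at t)" for t
  proof -
    obtain D where D: "(v has_real_derivative D) (at t)" "((\<lambda>\<rho>. d_t V \<rho> t) \<longlongrightarrow> D) (at_right 0)"
      using boundary_trace_derivative[OF smooth _ dirichlet] regular
      unfolding regular_up_to_boundary_def by metis
    obtain L where L: "((\<lambda>\<rho>. \<rho> powr a_exp \<gamma> * d_rho V \<rho> t) \<longlongrightarrow> L) (at_right 0)"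
      "- d_tilde \<gamma> * L = c_const n \<gamma> * v t powr (p - 1)"
      using neumann[of t] unfolding p(2) by blast
    obtain M where M: "\<And>\<rho> s. \<rho> \<in> {0<..<2} \<Longrightarrow> s \<in> {t-1..t+1} \<Longrightarrow>
        \<bar>energy_form n \<gamma> V (d_t V) s \<rho>\<bar> \<le> M * (\<rho> powr a_exp \<gamma> + \<rho> powr - a_exp \<gamma>)"
      using energy_form_bound[OF fin fin_t] by metis
    have "((\<lambda>s. LINT \<rho>:{0<..<2}|lborel. energy_form n \<gamma> V V s \<rho>) has_real_derivative
        (LINT \<rho>:{0<..<2}|lborel. 2 * energy_form n \<gamma> V (d_t V) t \<rho>)) (at t)"
    proof (rule has_real_derivative_set_integral)
      show "set_integrable lborel {0<..<2} (\<lambda>\<rho>. (2 * M) * (\<rho> powr a_exp \<gamma> + \<rho> powr - a_exp \<gamma>))"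
        by (rule set_integrable_weight[OF \<gamma>])
      show "\<bar>2 * energy_form n \<gamma> V (d_t V) s \<rho>\<bar> \<le> (2 * M) * (\<rho> powr a_exp \<gamma> + \<rho> powr - a_exp \<gamma>)"
        if "\<rho> \<in> {0<..<2}" "\<bar>s - t\<bar> \<le> 1" for s \<rho>
        using M[of \<rho> s] that by (auto simp: abs_le_iff)
      show "set_integrable lborel {0<..<2} (\<lambda>\<rho>. 2 * energy_form n \<gamma> V (d_t V) t \<rho>)"
        by (intro set_integrable_mult_right set_integrable_energy_form \<gamma> fin fin_t)
    qed (use int energy_form_has_derivative[OF smooth] in auto)
    moreover have "(LINT \<rho>:{0<..<2}|lborel. 2 * energy_form n \<gamma> V (d_t V) t \<rho>) = 2 * (L * D)"
      using integral_energy_form_d_t[OF n \<gamma> fin fin_t _ L(1) D(2)] equation by simp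
    ultimately have "(hamiltonian n \<gamma> V v has_real_derivative
        1 / 2 * (2 * (L * D)) + C_const n \<gamma> * (p * v t powr (p - 1) * D)) (at t)"
      unfolding hamiltonian_def[abs_def] ham_integrand_eq p_def[symmetric]
      by (intro DERIV_add DERIV_cmult has_real_derivative_powr_nonneg v_nonneg D(1) p(1)) simp_all
    moreover have "L = - (C_const n \<gamma> * p * v t powr (p - 1))"
    proof -
      have "C_const n \<gamma> * p = c_const n \<gamma> / d_tilde \<gamma>"
        using np n by (simp add: C_const_def p_def)
      then have "C_const n \<gamma> * p * v t powr (p - 1) = - (d_tilde \<gamma> * L) / d_tilde \<gamma>"
        using L(2) by simp
      then show ?thesis
        using d_tilde_nonzero[OF \<gamma>] by simp
    qed
    ultimately show ?thesis by (simp add: algebra_simps)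
  qed
  then have "hamiltonian n \<gamma> V v constant_on UNIV"
    by (intro has_field_derivative_0_imp_constant_on) auto
  with int show ?thesis by (simp add: ham_integrand_eq)
qed

end
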